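(* Let $p_1<p_2<p_3$ be odd primes with $p_2\equiv 1 \pmod{p_1}$ and $p_3\equiv 1\pmod{p_1p_2}$. Let $q_2=\lfloor p_2/p_1\rfloor=(p_2-1)/p_1$ and $q_3=\lfloor p_3/(p_1p_2)\rfloor=(p_3-1)/(p_1p_2)$. Let $$I=\{0,\ldots,p_1-2\}\times\{0,\ldots,q_2-1\}\times\{0,\ldots,p_1-1\}\times\{0,\ldots,q_3-1\},$$ $$\rho=\big((p_2-1)(p_3-1),\ p_1(p_3-1),\ p_3-1,\ p_1p_2\big),$$ and for $i=(i_1,i_2,i_3,i_4)\in I$ write $i\cdot\rho=i_1\rho_1+i_2\rho_2+i_3\rho_3+i_4\rho_4$. For $i\in I$ define $$g_i=\begin{cases} +x^{i_1p_2+i_2p_1+1}\sum_{k=0}^{p_1-2-i_1}x^k & \text{if } i_3\le i_1,\\ -x^{i_1(p_2-1)+(i_2+1)p_1}\sum_{k=0}^{i_1}x^k & \text{if } i_3>i_1,\end{cases}\qquad f_i=1+g_i-x^{(i_1+1)p_2}-x^{p_2}g_i .$$ Then: (C1) $\displaystyle \Phi_{p_1p_2p_3}=\sum_{i\in I} f_i\,x^{i\cdot\rho}+x^{\varphi(p_1p_2p_3)}$. (C2) If each $f_i$ is expanded as the list of monomials $1$, the monomials $\pm x^{e}$ of $g_i$ (one for each $k$ in its sum), $-x^{(i_1+1)p_2}$, and the monomials of $-x^{p_2}g_i$ (one for each $k$), and the summation over $i\in I$ is carried out as iterated sums $\sum_{i_1}\sum_{i_2}\sum_{i_3}\sum_{i_4}$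 (i.e. $i$ in lexicographic order), followed by the final term $x^{\varphi(p_1p_2p_3)}$, then all monomials in the resulting expression have pairwise distinct exponents (there is no cancellation or accumulation of terms) and their exponents appear in strictly ascending order.
   Context: $\Phi_n$ denotes the $n$-th cyclotomic polynomial (the monic polynomial in $\mathbb{Z}[x]$ whose roots are the primitive $n$-th roots of unity), and $\varphi$ is Euler's totient function, so $\varphi(p_1p_2p_3)=(p_1-1)(p_2-1)(p_3-1)=\deg\Phi_{p_1p_2p_3}$. *)

theory Defs
  imports
    "HOL-Computational_Algebra.Computational_Algebra"
    "HOL-Number_Theory.Cong"
    "HOL-Number_Theory.Totient"
begin

section \<open>Cyclotomic polynomials\<close>

definition primitive_unity_roots :: "nat \<Rightarrow> complex set" where
  "primitive_unity_roots n = {z. z ^ n = 1 \<and> (\<forall>m. 0 < m \<and> m < n \<longrightarrow> z ^ m \<noteq> 1)}"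

text \<open>
  The description determines the polynomial for every \<open>n > 0\<close>; see
  \<open>cyclotomic_poly_prod\<close> below.
\<close>

definition cyclotomic_poly :: "nat \<Rightarrow> int poly" where
  "cyclotomic_poly n =
     (THE p. map_poly of_int p = (\<Prod>z\<in>primitive_unity_roots n. [:- z, 1:]))"

lemma finite_primitive_unity_roots:
  "n > 0 \<Longrightarrow> finite (primitive_unity_roots n)"
  by (rule finite_subset[of _ "{z. z ^ n = 1}"])
     (auto simp: primitive_unity_roots_def intro: finite_roots_unity)

lemma roots_unity_decompose:
  assumes "n > 0"
  shows "{z::complex. z ^ n = 1} = (\<Union>d\<in>{d. d dvd n}. primitive_unity_roots d)"
proof (intro equalityI subsetI)
  fix z :: complex
  assume "z \<in> {z. z ^ n = 1}"
  hence z: "z ^ n = 1" by simp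
  define d where "d = (LEAST d. 0 < d \<and> z ^ d = 1)"
  have d: "0 < d \<and> z ^ d = 1"
    unfolding d_def by (rule LeastI[of _ n]) (use assms z in simp)
  have least: "z ^ m \<noteq> 1" if "0 < m" "m < d" for m
    using not_less_Least[of m "\<lambda>d. 0 < d \<and> z ^ d = 1"] that unfolding d_def by blast
  have "z ^ n = z ^ (d * (n div d) + n mod d)" by simp
  also have "\<dots> = (z ^ d) ^ (n div d) * z ^ (n mod d)"
    by (simp only: power_add power_mult)
  finally have "z ^ (n mod d) = 1" using d z by simp
  hence "n mod d = 0" using least[of "n mod d"] d by fastforce
  hence "d dvd n" by auto
  moreover have "z \<in> primitive_unity_roots d"
    using d least by (auto simp: primitive_unity_roots_def)
  ultimately show "z \<in> (\<Union>d\<in>{d. d dvd n}. primitive_unity_roots d)" by blast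
next
  fix z :: complex
  assume "z \<in> (\<Union>d\<in>{d. d dvd n}. primitive_unity_roots d)"
  then obtain d where "d dvd n" "z ^ d = 1" by (auto simp: primitive_unity_roots_def)
  thus "z \<in> {z. z ^ n = 1}" by (auto simp: power_mult elim!: dvdE)
qed

lemma prod_roots_unity:
  assumes "n > 0"
  shows "(\<Prod>z\<in>{z::complex. z ^ n = 1}. [:- z, 1:]) = monom 1 n - 1"
proof (rule poly_eqI_degree_lead_coeff[where n = n and A = "{z. z ^ n = 1}"])
  let ?R = "{z::complex. z ^ n = 1}"
  let ?P = "\<Prod>z\<in>?R. [:- z, 1:]"
  have fin: "finite ?R" using assms by (intro finite_roots_unity) auto
  have card: "card ?R = n" using assms by (rule card_roots_unity_eq)
  have deg: "degree ?P = n" by (subst degree_prod_sum_eq) (simp_all add: card)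
  have "lead_coeff ?P = 1" by (simp add: lead_coeff_prod)
  thus "coeff ?P n = coeff (monom 1 n - 1) n" using assms by (simp add: deg)
  show "n \<le> card ?R" "degree ?P \<le> n" by (simp_all add: card deg)
  show "degree (monom 1 n - 1 :: complex poly) \<le> n"
    by (rule degree_diff_le) (simp_all add: degree_monom_le)
  show "poly ?P z = poly (monom 1 n - 1) z" if "z \<in> ?R" for z
  proof -
    have "poly ?P z = 0" unfolding poly_prod using fin that by (intro prod_zero) auto
    thus ?thesis using that by (simp add: poly_monom)
  qed
qed

lemma prod_primitive_unity_roots:
  assumes "n > 0"
  shows "(\<Prod>d\<in>{d. d dvd n}. \<Prod>z\<in>primitive_unity_roots d. [:- z, 1:]) = monom 1 n - 1"
proof -
  have pos: "d > 0" if "d dvd n" for d using assms that by (rule dvd_pos_nat)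
  have disj: "primitive_unity_roots d \<inter> primitive_unity_roots e = {}"
    if "d dvd n" "e dvd n" "d \<noteq> e" for d e
    using pos[OF that(1)] pos[OF that(2)] that(3)
    unfolding primitive_unity_roots_def by (cases d e rule: linorder_cases) blast+
  have "monom 1 n - 1 = (\<Prod>z\<in>(\<Union>d\<in>{d. d dvd n}. primitive_unity_roots d). [:- z, 1:])"
    using prod_roots_unity[OF assms] roots_unity_decompose[OF assms] by simp
  also have "\<dots> = (\<Prod>d\<in>{d. d dvd n}. \<Prod>z\<in>primitive_unity_roots d. [:- z, 1:])"
    by (rule prod.UNION_disjoint)
       (use assms pos disj in \<open>auto intro: finite_primitive_unity_roots\<close>)
  finally show ?thesis by simp
qed

lemma Ints_coeff_mult:
  fixes p q :: "complex poly"
  assumes "\<And>i. coeff p i \<in> \<int>" "\<And>i. coeff q i \<in> \<int>"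
  shows "coeff (p * q) i \<in> \<int>"
  using assms by (auto simp: coeff_mult intro!: Ints_sum Ints_mult)

lemma Ints_coeff_prod:
  fixes p :: "'a \<Rightarrow> complex poly"
  assumes "\<And>x i. x \<in> A \<Longrightarrow> coeff (p x) i \<in> \<int>"
  shows "coeff (prod p A) i \<in> \<int>"
  using assms
proof (induction A arbitrary: i rule: infinite_finite_induct)
  case (insert x A)
  thus ?case by (simp add: Ints_coeff_mult)
qed (auto simp: coeff_1)

lemma Ints_coeff_quotient:
  fixes a b :: "complex poly"
  assumes monic: "lead_coeff a = 1"
    and a: "\<And>i. coeff a i \<in> \<int>" and ab: "\<And>i. coeff (a * b) i \<in> \<int>"
  shows "coeff b k \<in> \<int>"
proof (induction "Suc (degree b) - k" arbitrary: k rule: less_induct)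
  case less
  show ?case
  proof (cases "k > degree b")
    case True
    thus ?thesis by (simp add: coeff_eq_0)
  next
    case False
    have "coeff (a * b) (degree a + k) =
        (\<Sum>i\<le>degree a + k. coeff a i * coeff b (degree a + k - i))"
      by (simp add: coeff_mult)
    also have "\<dots> = (\<Sum>i\<le>degree a. coeff a i * coeff b (degree a + k - i))"
      by (rule sum.mono_neutral_right) (auto simp: coeff_eq_0)
    also have "{..degree a} = insert (degree a) {..<degree a}" by auto
    finally have "coeff b k = coeff (a * b) (degree a + k) -
        (\<Sum>i<degree a. coeff a i * coeff b (degree a + k - i))"
      using monic by simp
    moreover have "coeff b (degree a + k - i) \<in> \<int>" if "i < degree a" for i
      by (rule less) (use that False in auto)
    ultimately show ?thesis
      using a ab by (auto intro!: Ints_diff Ints_sum Ints_mult)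
  qed
qed

lemma Ints_coeff_prod_primitive_unity_roots:
  "n > 0 \<Longrightarrow> coeff (\<Prod>z\<in>primitive_unity_roots n. [:- z, 1:]) i \<in> \<int>"
proof (induction n arbitrary: i rule: less_induct)
  case (less n)
  let ?F = "\<lambda>d. \<Prod>z\<in>primitive_unity_roots d. [:- z, 1:]"
  let ?a = "\<Prod>d\<in>{d. d dvd n} - {n}. ?F d"
  have d: "d < n" "d > 0" if "d \<in> {d. d dvd n} - {n}" for d
    using that less.prems dvd_pos_nat[of n d] dvd_imp_le[of d n] by auto
  have a: "coeff ?a i \<in> \<int>" for i
    by (rule Ints_coeff_prod) (rule less.IH[OF d])
  have "finite {d. d dvd n}" using less.prems by simp
  hence "?a * ?F n = monom 1 n - 1"
    using prod.remove[of "{d. d dvd n}" n ?F] prod_primitive_unity_roots[OF less.prems]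
    by (simp add: mult.commute)
  hence "coeff (?a * ?F n) i \<in> \<int>" for i
    by (simp add: coeff_diff)
  moreover have "lead_coeff ?a = 1" by (simp add: lead_coeff_prod)
  ultimately show ?case using a Ints_coeff_quotient by blast
qed

lemma cyclotomic_poly_prod:
  assumes "n > 0"
  shows "map_poly of_int (cyclotomic_poly n) = (\<Prod>z\<in>primitive_unity_roots n. [:- z, 1:])"
proof -
  obtain q where q: "(\<Prod>z\<in>primitive_unity_roots n. [:- z, 1:]) = map_poly of_int q"
    using intpolyE[of "\<Prod>z\<in>primitive_unity_roots n. [:- z, 1:]"]
      Ints_coeff_prod_primitive_unity_roots[OF assms] by blast
  show ?thesis unfolding cyclotomic_poly_def
  proof (rule theI[of _ q])
    fix p assume "map_poly of_int p = (\<Prod>z\<in>primitive_unity_roots n. [:- z, 1:])"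
    hence "map_poly of_int p = (map_poly of_int q :: complex poly)" using q by simp
    hence "of_int (coeff p i) = (of_int (coeff q i) :: complex)" for i
      by (metis coeff_map_poly of_int_0)
    thus "p = q" by (simp add: poly_eq_iff)
  qed (use q in simp)
qed


section \<open>The summands and their monomial expansions\<close>

type_synonym idx = "nat \<times> nat \<times> nat \<times> nat"

definition idx_set :: "nat \<Rightarrow> nat \<Rightarrow> nat \<Rightarrow> idx set" where
  "idx_set p1 p2 p3 =
     {0..<p1 - 1} \<times> {0..<p2 div p1} \<times> {0..<p1} \<times> {0..<p3 div (p1 * p2)}"

fun idx_dot_rho :: "nat \<Rightarrow> nat \<Rightarrow> nat \<Rightarrow> idx \<Rightarrow> nat" where
  "idx_dot_rho p1 p2 p3 (i1, i2, i3, i4) =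
     i1 * ((p2 - 1) * (p3 - 1)) + i2 * (p1 * (p3 - 1)) + i3 * (p3 - 1) + i4 * (p1 * p2)"

fun g_poly :: "nat \<Rightarrow> nat \<Rightarrow> idx \<Rightarrow> int poly" where
  "g_poly p1 p2 (i1, i2, i3, i4) =
     (if i3 \<le> i1
      then monom 1 (i1 * p2 + i2 * p1 + 1) * (\<Sum>k = 0..p1 - 2 - i1. monom 1 k)
      else - (monom 1 (i1 * (p2 - 1) + (i2 + 1) * p1) * (\<Sum>k = 0..i1. monom 1 k)))"

definition f_poly :: "nat \<Rightarrow> nat \<Rightarrow> idx \<Rightarrow> int poly" where
  "f_poly p1 p2 i =
     1 + g_poly p1 p2 i - monom 1 ((fst i + 1) * p2) - monom 1 p2 * g_poly p1 p2 i"

text \<open>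
  An expression expanded into monomials is a list of pairs \<open>(c, e)\<close>, each standing for
  \<open>c x\<^sup>e\<close>, in the order in which the monomials are written; equal exponents are not merged.
\<close>

type_synonym monomials = "(int \<times> nat) list"

definition eval_monomials :: "monomials \<Rightarrow> int poly" where
  "eval_monomials ms = (\<Sum>(c, e)\<leftarrow>ms. monom c e)"

definition shift_monomials :: "nat \<Rightarrow> monomials \<Rightarrow> monomials" where
  "shift_monomials d ms = map (\<lambda>(c, e). (c, e + d)) ms"

definition negate_monomials :: "monomials \<Rightarrow> monomials" where
  "negate_monomials ms = map (\<lambda>(c, e). (- c, e)) ms"

fun g_monomials :: "nat \<Rightarrow> nat \<Rightarrow> idx \<Rightarrow> monomials" where
  "g_monomials p1 p2 (i1, i2, i3, i4) =
     (if i3 \<le> i1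
      then map (\<lambda>k. (1, i1 * p2 + i2 * p1 + 1 + k)) [0..<Suc (p1 - 2 - i1)]
      else map (\<lambda>k. (- 1, i1 * (p2 - 1) + (i2 + 1) * p1 + k)) [0..<Suc i1])"

definition f_monomials :: "nat \<Rightarrow> nat \<Rightarrow> idx \<Rightarrow> monomials" where
  "f_monomials p1 p2 i =
     [(1, 0)] @ g_monomials p1 p2 i @ [(- 1, (fst i + 1) * p2)]
       @ negate_monomials (shift_monomials p2 (g_monomials p1 p2 i))"

text \<open>\<^const>\<open>List.product\<close> enumerates pairs lexicographically.\<close>

definition idx_list :: "nat \<Rightarrow> nat \<Rightarrow> nat \<Rightarrow> idx list" where
  "idx_list p1 p2 p3 =
     List.product [0..<p1 - 1]
       (List.product [0..<p2 div p1] (List.product [0..<p1] [0..<p3 div (p1 * p2)]))"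

definition full_expansion :: "nat \<Rightarrow> nat \<Rightarrow> nat \<Rightarrow> monomials" where
  "full_expansion p1 p2 p3 =
     concat (map (\<lambda>i. shift_monomials (idx_dot_rho p1 p2 p3 i) (f_monomials p1 p2 i))
       (idx_list p1 p2 p3)) @ [(1, totient (p1 * p2 * p3))]"

lemma eval_monomials_simps [simp]:
  "eval_monomials [] = 0"
  "eval_monomials ((c, e) # ms) = monom c e + eval_monomials ms"
  "eval_monomials (ms @ ms') = eval_monomials ms + eval_monomials ms'"
  by (simp_all add: eval_monomials_def)

lemma eval_shift_monomials: "eval_monomials (shift_monomials d ms) = eval_monomials ms * monom 1 d"
  by (induction ms) (auto simp: shift_monomials_def mult_monom algebra_simps)

lemma eval_negate_monomials: "eval_monomials (negate_monomials ms) = - eval_monomials ms"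
  by (induction ms) (auto simp: negate_monomials_def minus_monom[symmetric])

lemma eval_monomials_map:
  "eval_monomials (map (\<lambda>k. (c, e + k)) [0..<Suc n]) =
     monom c e * (\<Sum>k = 0..n. monom 1 k)"
  by (induction n) (simp_all add: mult_monom algebra_simps)

lemma eval_g_monomials: "eval_monomials (g_monomials p1 p2 i) = g_poly p1 p2 i"
proof (cases i)
  case (fields i1 i2 i3 i4)
  show ?thesis
    unfolding fields g_monomials.simps g_poly.simps if_distrib[of eval_monomials]
      eval_monomials_map minus_monom[symmetric] mult_minus_left ..
qed

lemma eval_f_monomials: "eval_monomials (f_monomials p1 p2 i) = f_poly p1 p2 i"
  by (simp add: f_monomials_def f_poly_def eval_g_monomials eval_negate_monomials
      eval_shift_monomials minus_monom[symmetric] mult.commute)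

lemma eval_full_expansion:
  "eval_monomials (full_expansion p1 p2 p3) =
     (\<Sum>i\<in>idx_set p1 p2 p3. f_poly p1 p2 i * monom 1 (idx_dot_rho p1 p2 p3 i))
       + monom 1 (totient (p1 * p2 * p3))"
proof -
  have concat: "eval_monomials (concat (map h is)) = (\<Sum>i\<leftarrow>is. eval_monomials (h i))"
    for h :: "idx \<Rightarrow> monomials" and "is"
    by (induction "is") auto
  have "distinct (idx_list p1 p2 p3)" "set (idx_list p1 p2 p3) = idx_set p1 p2 p3"
    by (auto simp: idx_list_def idx_set_def distinct_product)
  thus ?thesis
    by (simp add: full_expansion_def concat eval_shift_monomials eval_f_monomials
        sum_list_distinct_conv_sum_set)
qed

end

theory Submission
  imports Defs
begin

text \<open>
  Write \<open>p < q < r\<close> for the primes and put \<open>y = x\<^sup>r\<^sup>-\<^sup>1\<close>, \<open>z = x y = x\<^sup>r\<close>. Since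
  \<open>\<Phi>\<^sub>p\<^sub>q\<^sub>r(x) = \<Phi>\<^sub>p\<^sub>q(z) / \<Phi>\<^sub>p\<^sub>q(x)\<close> and the sum over \<open>i\<^sub>4\<close> is the geometric sum
  \<open>(y - 1) / (x\<^sup>p\<^sup>q - 1)\<close>, the claim becomes an identity in independent variables \<open>x\<close>, \<open>y\<close>.
  The exponent \<open>m = i\<^sub>1 (q - 1) + i\<^sub>2 p + i\<^sub>3\<close> of \<open>y\<close> runs through \<open>0, \<dots>, \<phi>(pq) - 1\<close>, and \<open>f\<^sub>i\<close> is
  \<open>(1 - x\<^sup>q) (1 + x + \<dots> + x\<^sup>p\<^sup>-\<^sup>1)\<close> times the truncation of \<open>\<Phi>\<^sub>p\<^sub>q(x)\<close> after degree \<open>m\<close>.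
  Multiplying by \<open>y - 1\<close> hence telescopes and leaves the coefficients of \<open>\<Phi>\<^sub>p\<^sub>q(x y)\<close>.
  The order of the exponents is a mixed radix expansion: all exponents of \<open>f\<^sub>i\<close> are below \<open>p q\<close>,
  and each entry of \<open>\<rho>\<close> is the next one multiplied by the range of its index.
\<close>

section \<open>Products of cyclotomic polynomials\<close>

lemma map_poly_of_int_mult:
  "map_poly of_int (p * q) = (map_poly of_int p * map_poly of_int q :: complex poly)"
  by (rule poly_eqI) (simp add: coeff_map_poly coeff_mult)

lemma map_poly_of_int_prod:
  "map_poly of_int (\<Prod>x\<in>A. f x) = (\<Prod>x\<in>A. map_poly of_int (f x) :: complex poly)"
  by (induction A rule: infinite_finite_induct) (simp_all add: map_poly_of_int_mult map_poly_1')

lemma prod_cyclotomic_poly: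
  assumes "n > 0"
  shows "(\<Prod>d\<in>{d. d dvd n}. cyclotomic_poly d) = monom 1 n - 1"
proof -
  have "map_poly of_int (\<Prod>d\<in>{d. d dvd n}. cyclotomic_poly d) =
      (\<Prod>d\<in>{d. d dvd n}. map_poly of_int (cyclotomic_poly d) :: complex poly)"
    by (rule map_poly_of_int_prod)
  also have "\<dots> = (\<Prod>d\<in>{d. d dvd n}. \<Prod>z\<in>primitive_unity_roots d. [:- z, 1:])"
    by (rule prod.cong) (use assms in \<open>auto intro!: cyclotomic_poly_prod dvd_pos_nat[of n]\<close>)
  also have "\<dots> = monom 1 n - 1"
    by (rule prod_primitive_unity_roots[OF assms])
  also have "\<dots> = map_poly of_int (monom 1 n - 1)"
    by (rule poly_eqI) (simp add: coeff_map_poly coeff_1)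
  finally have "coeff (\<Prod>d\<in>{d. d dvd n}. cyclotomic_poly d) i = coeff (monom 1 n - 1) i" for i
    by (metis coeff_map_poly of_int_0 of_int_eq_iff)
  thus ?thesis by (rule poly_eqI)
qed

text \<open>A divisor of \<open>p * n\<close> not divisible by \<open>p\<close> is coprime to
  \<open>p\<close> and so divides \<open>n\<close>; any other is \<open>p\<close> times a divisor of
  \<open>n\<close>.\<close>

lemma prod_divisors_prime_mult:
  fixes G :: "nat \<Rightarrow> 'a::comm_monoid_mult"
  assumes p: "prime p" "\<not> p dvd n" and n: "n > 0"
  shows "(\<Prod>d\<in>{d. d dvd p * n}. G d) = (\<Prod>d\<in>{d. d dvd n}. G d) * (\<Prod>d\<in>{d. d dvd n}. G (p * d))"
proof -
  have "{d. d dvd p * n} = {d. d dvd n} \<union> (*) p ` {d. d dvd n}"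
  proof (intro equalityI subsetI)
    fix d assume "d \<in> {d. d dvd p * n}"
    then have d: "d dvd p * n" by simp
    show "d \<in> {d. d dvd n} \<union> (*) p ` {d. d dvd n}"
    proof (cases "p dvd d")
      case True
      then obtain e where "d = p * e" ..
      with d p show ?thesis by (auto simp: prime_gt_0_nat)
    next
      case False
      with p have "coprime d p" using prime_imp_coprime[of p d] by (simp add: coprime_commute)
      with d show ?thesis by (simp add: coprime_dvd_mult_right_iff)
    qed
  qed auto
  moreover have "{d. d dvd n} \<inter> (*) p ` {d. d dvd n} = {}"
    using p by (auto dest: dvd_mult_left)
  moreover have "inj_on ((*) p) {d. d dvd n}"
    using p by (auto simp: inj_on_def prime_gt_0_nat)
  ultimately show ?thesis
    using n by (simp add: prod.union_disjoint prod.reindex)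
qed

text \<open>Moebius inversion with denominators cleared: once each \<open>monom 1 n - 1\<close> is
  factored over the divisors of \<open>n\<close>, both sides contain every cyclotomic factor equally
  often.\<close>

lemma cyclotomic_poly_three_primes:
  assumes "prime p" "prime q" "prime r" "p \<noteq> q" "p \<noteq> r" "q \<noteq> r"
  shows "cyclotomic_poly (p * q * r) *
      ((monom 1 (p * q) - 1) * (monom 1 (p * r) - 1) * (monom 1 (q * r) - 1) * (monom 1 1 - 1)) =
    (monom 1 (p * q * r) - 1) * (monom 1 p - 1) * (monom 1 q - 1) * (monom 1 r - 1)"
proof -
  have nd: "\<not> p dvd q" "\<not> p dvd r" "\<not> q dvd r" "\<not> p dvd q * r"
    using assms by (auto simp: primes_dvd_imp_eq prime_dvd_mult_iff)
  have pos: "p > 0" "q > 0" "r > 0"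
    using assms by (auto simp: prime_gt_0_nat)
  let ?D = "\<lambda>n G. (\<Prod>d\<in>{d. d dvd n}. G d) :: int poly"
  have D1: "?D p G = G 1 * G p" if "prime p" for p :: nat and G
    using prod_divisors_prime_mult[of p 1 G] that by (auto simp: prime_nat_iff)
  have D2: "?D (p * q) G = G 1 * G q * (G p * G (p * q))"
    if "prime p" "prime q" "\<not> p dvd q" for p q :: nat and G
    using prod_divisors_prime_mult[of p q G] D1[of q] that by (simp add: prime_gt_0_nat)
  have D3: "?D (p * (q * r)) G = G 1 * G r * (G q * G (q * r)) *
      (G p * G (p * r) * (G (p * q) * G (p * (q * r))))" for G
    using prod_divisors_prime_mult[of p "q * r" G] D2[of q r] assms nd pos by simp
  show ?thesis
    using D1[of p cyclotomic_poly] D1[of q cyclotomic_poly] D1[of r cyclotomic_poly]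
      D2[of p q cyclotomic_poly] D2[of p r cyclotomic_poly] D2[of q r cyclotomic_poly]
      D3[of cyclotomic_poly] prod_cyclotomic_poly[of 1] assms nd pos
    by (simp add: prod_cyclotomic_poly mult.assoc)
qed


section \<open>The telescoping identity\<close>

definition geo :: "'a::comm_ring_1 \<Rightarrow> nat \<Rightarrow> 'a" where
  "geo x n = (\<Sum>k<n. x ^ k)"

lemma geo_add: "geo x (m + n) = geo x m + x ^ m * geo x n"
  by (induction n) (simp_all add: geo_def algebra_simps power_add)

lemma geo_mult: "geo x n * (x - 1) = x ^ n - 1"
  unfolding geo_def by (induction n) (simp_all add: algebra_simps)

lemma geo_power_mult: "(\<Sum>k<n. x ^ (k * m)) * (x ^ m - 1) = x ^ (n * m) - (1 :: 'a::comm_ring_1)"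
  using geo_mult[of "x ^ m" n] by (simp add: geo_def power_mult[symmetric] mult.commute)

text \<open>This is \<open>f_poly\<close> at a point of any commutative ring. The index
  \<open>i4\<close> is dropped because \<open>f_poly\<close> does not depend on it, and
  \<open>geo\<close> counts terms, so the last exponent \<open>p - 2 - i\<close> becomes the length
  \<open>p - 1 - i\<close>.\<close>

definition f_val :: "nat \<Rightarrow> nat \<Rightarrow> 'a::comm_ring_1 \<Rightarrow> nat \<Rightarrow> nat \<Rightarrow> nat \<Rightarrow> 'a" where
  "f_val p q x i j k = 1 - x ^ ((i + 1) * q) + (1 - x ^ q) *
     (if k \<le> i then x ^ (i * q + j * p + 1) * geo x (p - 1 - i)
      else - (x ^ (i * (q - 1) + (j + 1) * p) * geo x (i + 1)))"

text \<open>
  The value of \<^term>\<open>f_val\<close> at the predecessor of \<open>(i, j, 0)\<close>; the formula extends it to \<open>j = 0\<close>,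
  where the predecessor lies in the block of \<open>i - 1\<close>.
\<close>

definition f_before :: "nat \<Rightarrow> nat \<Rightarrow> 'a::comm_ring_1 \<Rightarrow> nat \<Rightarrow> nat \<Rightarrow> 'a" where
  "f_before p q x i j =
     1 - x ^ ((i + 1) * q) - (1 - x ^ q) * x ^ (i * (q - 1) + j * p) * geo x (i + 1)"

text \<open>The cyclotomic polynomial of order \<open>p q\<close> at \<open>z\<close>, where \<open>q = p b + 1\<close>.\<close>

definition cyclo2 :: "nat \<Rightarrow> nat \<Rightarrow> 'a::comm_ring_1 \<Rightarrow> 'a" where
  "cyclo2 p b z = (\<Sum>i<p-1. \<Sum>j<b. z ^ (i * (p * b) + j * p) * (1 - z ^ (i + 1)))
     + z ^ ((p - 1) * (p * b))"

text \<open>The factor \<open>z ^ p - 1\<close> collapses the sums over \<open>j\<close>. Since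
  \<open>i * (p * b) + i = i * q\<close>, two geometric sums in \<open>i\<close> remain, with ratios
  \<open>z ^ (p * b)\<close> and \<open>z ^ q\<close>; the first collapses at once, the second under
  \<open>z ^ q - 1\<close>.\<close>

lemma cyclo2_mult:
  fixes z :: "'a::comm_ring_1"
  assumes p: "p > 0" and q: "q = p * b + 1"
  shows "cyclo2 p b z * ((z ^ p - 1) * (z ^ q - 1)) = (z ^ (p * q) - 1) * (z - 1)"
proof -
  obtain m where m: "p = Suc m" using p by (cases p) auto
  let ?n = "p * b"
  have "(\<Sum>i<m. \<Sum>j<b. z ^ (i * ?n + j * p) * (1 - z ^ (i + 1))) * (z ^ p - 1) =
      (\<Sum>i<m. z ^ (i * ?n) * (1 - z ^ (i + 1)) * ((\<Sum>j<b. z ^ (j * p)) * (z ^ p - 1)))"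
    unfolding sum_distrib_left sum_distrib_right
    by (intro sum.cong refl) (simp add: power_add ac_simps)
  also have "\<dots> = (\<Sum>i<m. (z ^ (i * ?n) - z * z ^ (i * q)) * (z ^ ?n - 1))"
    unfolding geo_power_mult
    by (intro sum.cong refl) (simp add: q power_add algebra_simps)
  also have "\<dots> = (z ^ (m * ?n) - 1) - z * (z ^ ?n - 1) * (\<Sum>i<m. z ^ (i * q))"
    unfolding geo_power_mult[symmetric] sum_distrib_right[symmetric] sum_subtractf
      sum_distrib_left[symmetric]
    by (simp add: algebra_simps)
  finally have "cyclo2 p b z * (z ^ p - 1) =
      z ^ (m * ?n + p) - 1 - z * (z ^ ?n - 1) * (\<Sum>i<m. z ^ (i * q))"
    by (simp add: cyclo2_def m algebra_simps power_add)
  hence "cyclo2 p b z * ((z ^ p - 1) * (z ^ q - 1)) =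
      (z ^ (m * ?n + p) - 1 - z * (z ^ ?n - 1) * (\<Sum>i<m. z ^ (i * q))) * (z ^ q - 1)"
    by (simp only: mult.assoc[symmetric])
  also have "\<dots> = (z ^ (m * ?n + p) - 1) * (z ^ q - 1) - z * (z ^ ?n - 1) * (z ^ (m * q) - 1)"
    by (simp only: left_diff_distrib[of _ _ "z ^ q - 1"] mult.assoc geo_power_mult)
  also have "m * ?n + p = m * q + 1" by (simp add: q m)
  also have "(z ^ (m * q + 1) - 1) * (z ^ q - 1) - z * (z ^ ?n - 1) * (z ^ (m * q) - 1) =
      (z ^ (p * q) - 1) * (z - 1)"
  proof -
    have "z ^ (p * q) = z ^ (m * q) * z ^ q" by (simp add: m power_add mult.commute)
    moreover have "z ^ q = z * z ^ ?n" by (simp add: q)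
    ultimately show ?thesis by (simp add: algebra_simps)
  qed
  finally show ?thesis .
qed

text \<open>From \<open>k = 0\<close> to \<open>k = i\<close> the truncation gains a single
  coefficient of the cyclotomic polynomial of order \<open>p * q\<close>, the 1 at degree
  \<open>i * (q - 1) + j * p\<close>.\<close>

lemma f_val_low:
  assumes "q = p * b + 1" "i < p - 1" "k \<le> i"
  shows "f_val p q x i j k =
    f_before p q x i j + (1 - x ^ q) * geo x p * x ^ (i * (q - 1) + j * p)"
proof -
  have "geo x p = geo x (i + 1) + x ^ (i + 1) * geo x (p - 1 - i)"
    using geo_add[of x "i + 1" "p - 1 - i"] assms by simp
  moreover have "x ^ (i * q + j * p + 1) = x ^ (i * (q - 1) + j * p) * x ^ (i + 1)"
    using assms by (simp add: power_add[symmetric] algebra_simps)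
  ultimately show ?thesis using assms by (simp add: f_val_def f_before_def algebra_simps)
qed

text \<open>The coefficient -1 reached at \<open>k = i + 1\<close> is the last one before
  \<open>(i, j + 1, 0)\<close>.\<close>

lemma f_val_high: "k > i \<Longrightarrow> f_val p q x i j k = f_before p q x i (Suc j)"
  by (simp add: f_val_def f_before_def algebra_simps)

text \<open>The jump at \<open>k = i + 1\<close>. Cutting \<open>geo x p\<close> both after
  \<open>i + 1\<close> and after \<open>p - 1 - i\<close> terms turns the difference into a shift by
  \<open>x ^ (i + 1)\<close>.\<close>

lemma f_before_step:
  assumes "q = p * b + 1" "i < p - 1"
  shows "f_before p q x i j + (1 - x ^ q) * geo x p * x ^ (i * (q - 1) + j * p) -
    f_before p q x i (Suc j) = (1 - x ^ q) * geo x p * x ^ (i * (q - 1) + j * p + i + 1)"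
proof -
  have low: "geo x p = geo x (i + 1) + x ^ (i + 1) * geo x (p - 1 - i)"
    using geo_add[of x "i + 1" "p - 1 - i"] assms by simp
  have high: "geo x p = geo x (p - 1 - i) + x ^ (p - 1 - i) * geo x (i + 1)"
    using geo_add[of x "p - 1 - i" "i + 1"] assms by simp
  have split: "x ^ p = x ^ (p - 1 - i) * x ^ (i + 1)"
    using assms by (simp only: power_add[symmetric]) simp
  have "geo x p - geo x (i + 1) + x ^ p * geo x (i + 1) =
      x ^ (i + 1) * (geo x (p - 1 - i) + x ^ (p - 1 - i) * geo x (i + 1))"
    unfolding split by (subst low) (simp add: algebra_simps)
  hence "geo x p - geo x (i + 1) + x ^ p * geo x (i + 1) = x ^ (i + 1) * geo x p"
    by (simp only: high[symmetric])
  hence "(1 - x ^ q) * x ^ (i * (q - 1) + j * p) *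
      (geo x p - geo x (i + 1) + x ^ p * geo x (i + 1)) =
      (1 - x ^ q) * x ^ (i * (q - 1) + j * p) * (x ^ (i + 1) * geo x p)" by simp
  thus ?thesis by (simp add: f_before_def power_add algebra_simps)
qed

text \<open>Here \<open>i * (q - 1) + b * p = (i + 1) * (q - 1)\<close>, and the extra term
  \<open>x ^ (i + 1)\<close> of \<open>geo x (i + 2)\<close> compensates the change from
  \<open>x ^ ((i + 1) * q)\<close> to \<open>x ^ ((i + 2) * q)\<close>.\<close>

lemma f_before_wrap:
  assumes "q = p * b + 1"
  shows "f_before p q x i b = f_before p q x (Suc i) 0"
proof -
  have "x ^ ((i + 1) * q) = x ^ (i * (p * b) + b * p) * x ^ (i + 1)"
    using assms by (simp add: power_add[symmetric] algebra_simps)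
  thus ?thesis
    using assms geo_add[of x "i + 1" 1]
    by (simp add: f_before_def geo_def power_add algebra_simps)
qed

lemma sum_f_val:
  fixes x y :: "'a::comm_ring_1"
  assumes q: "q = p * b + 1" and p: "p > 0"
  shows "(\<Sum>i<p-1. \<Sum>j<b. \<Sum>k<p. f_val p q x i j k * y ^ (i * (q - 1) + j * p + k)) * (y - 1)
      + y ^ ((p - 1) * (q - 1)) * (x ^ (p * q) - 1)
    = (x ^ q - 1) * geo x p * cyclo2 p b (x * y)"
proof -
  let ?M = "\<lambda>i j. i * (q - 1) + j * p"
  let ?P = "(1 - x ^ q) * geo x p"
  let ?h = "f_before p q x"
  \<comment> \<open>Multiplying by \<open>y - 1\<close> leaves a telescoping difference and the
    jumps at \<open>k = 0\<close> and \<open>k = i + 1\<close>; up to the factor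
    \<open>- ?P\<close>, these form one summand of \<open>cyclo2\<close> at
    \<open>x * y\<close>.\<close>
  have inner: "(\<Sum>k<p. f_val p q x i j k * y ^ (?M i j + k)) * (y - 1) =
      (y ^ ?M i (Suc j) * ?h i (Suc j) - y ^ ?M i j * ?h i j)
      - ?P * ((x * y) ^ ?M i j * (1 - (x * y) ^ (i + 1)))" if i: "i < p - 1" for i j
  proof -
    have "(\<Sum>k<p. f_val p q x i j k * y ^ (?M i j + k)) =
        (\<Sum>k<i + 1 + (p - 1 - i). f_val p q x i j k * y ^ (?M i j + k))"
      using i by simp
    also have "\<dots> = (\<Sum>k<i + 1. f_val p q x i j k * y ^ (?M i j + k)) +
        (\<Sum>k<p - 1 - i. f_val p q x i j (i + 1 + k) * y ^ (?M i j + (i + 1 + k)))"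
    proof -
      have "(\<Sum>k<m + n. g k) = (\<Sum>k<m. g k) + (\<Sum>k<n. g (m + k))" for m n and g :: "nat \<Rightarrow> 'a"
        by (induction n) (simp_all add: algebra_simps)
      thus ?thesis by blast
    qed
    also have "(\<Sum>k<i + 1. f_val p q x i j k * y ^ (?M i j + k)) =
        (?h i j + ?P * x ^ ?M i j) * y ^ ?M i j * geo y (i + 1)"
      unfolding geo_def[of y] sum_distrib_left
      by (rule sum.cong) (use i in \<open>simp_all add: f_val_low[OF q] power_add mult.assoc\<close>)
    also have "(\<Sum>k<p - 1 - i. f_val p q x i j (i + 1 + k) * y ^ (?M i j + (i + 1 + k))) =
        ?h i (Suc j) * y ^ ?M i j * y ^ (i + 1) * geo y (p - 1 - i)"
      unfolding geo_def[of y] sum_distrib_left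
      by (rule sum.cong) (simp_all add: f_val_high power_add mult.assoc)
    finally have "(\<Sum>k<p. f_val p q x i j k * y ^ (?M i j + k)) * (y - 1) =
        (?h i j + ?P * x ^ ?M i j) * y ^ ?M i j * (geo y (i + 1) * (y - 1)) +
        ?h i (Suc j) * y ^ ?M i j * y ^ (i + 1) * (geo y (p - 1 - i) * (y - 1))"
      by (simp only: distrib_right mult.assoc)
    also have "\<dots> = y ^ ?M i j * ((?h i j + ?P * x ^ ?M i j - ?h i (Suc j)) * y ^ (i + 1)
        - (?h i j + ?P * x ^ ?M i j) + ?h i (Suc j) * (y ^ (i + 1) * y ^ (p - 1 - i)))"
      unfolding geo_mult by (simp add: algebra_simps)
    also have "?h i j + ?P * x ^ ?M i j - ?h i (Suc j) = ?P * x ^ (?M i j + i + 1)"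
      by (rule f_before_step[OF q i])
    also have "y ^ (i + 1) * y ^ (p - 1 - i) = y ^ p"
      using i by (simp only: power_add[symmetric]) simp
    finally show ?thesis by (simp add: power_add power_mult_distrib algebra_simps)
  qed
  have telescope: "(\<Sum>i<n. \<Sum>j<b. y ^ ?M i (Suc j) * ?h i (Suc j) - y ^ ?M i j * ?h i j) =
      y ^ ?M n 0 * ?h n 0" for n
  proof (induction n)
    case 0
    show ?case by (simp add: f_before_def geo_def)
  next
    case (Suc n)
    have "(\<Sum>j<b. y ^ ?M n (Suc j) * ?h n (Suc j) - y ^ ?M n j * ?h n j) =
        y ^ ?M n b * ?h n b - y ^ ?M n 0 * ?h n 0"
      by (rule sum_lessThan_telescope)
    moreover have "?M n b = ?M (Suc n) 0" by (simp add: q algebra_simps)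
    ultimately show ?case using Suc f_before_wrap[OF q, of x n] by (simp add: add.commute)
  qed
  have "(\<Sum>i<p-1. \<Sum>j<b. \<Sum>k<p. f_val p q x i j k * y ^ (?M i j + k)) * (y - 1) =
      (\<Sum>i<p-1. \<Sum>j<b. (y ^ ?M i (Suc j) * ?h i (Suc j) - y ^ ?M i j * ?h i j)
        - ?P * ((x * y) ^ ?M i j * (1 - (x * y) ^ (i + 1))))"
    unfolding sum_distrib_right
    by (intro sum.cong refl) (simp only: lessThan_iff inner[unfolded sum_distrib_right])
  also have "\<dots> = y ^ ?M (p - 1) 0 * ?h (p - 1) 0 -
      ?P * (\<Sum>i<p-1. \<Sum>j<b. (x * y) ^ ?M i j * (1 - (x * y) ^ (i + 1)))"
    by (simp only: sum_subtractf sum_distrib_left telescope[unfolded sum_subtractf])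
  \<comment> \<open>The index \<open>i = p - 1\<close> lies past the end of the sum: only the
    leading term is still missing from the truncation, and \<open>?P\<close> times the full
    polynomial is \<open>1 - x ^ (p * q)\<close>.\<close>
  also have "?h (p - 1) 0 = 1 - x ^ (p * q) - ?P * x ^ ((p - 1) * (q - 1))"
    using p by (simp add: f_before_def algebra_simps)
  also have "(\<Sum>i<p-1. \<Sum>j<b. (x * y) ^ ?M i j * (1 - (x * y) ^ (i + 1))) =
      cyclo2 p b (x * y) - (x * y) ^ ((p - 1) * (q - 1))"
    by (simp add: cyclo2_def q)
  finally show ?thesis by (simp add: power_mult_distrib algebra_simps)
qed


section \<open>Ascending blocks of exponents\<close>

definition ascending_below :: "nat \<Rightarrow> nat list \<Rightarrow> bool" where
  "ascending_below D es \<longleftrightarrow> sorted_wrt (<) es \<and> (\<forall>e\<in>set es. e < D)"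

text \<open>Block \<open>i\<close> stays within \<open>[i * D, (i + 1) * D)\<close>. The conclusion
  has the form of the hypothesis, so the lemma can be iterated over nested indices.\<close>

lemma ascending_below_concat:
  assumes "\<And>i. i < n \<Longrightarrow> ascending_below D (es i)"
  shows "ascending_below (n * D) (concat (map (\<lambda>i. map (\<lambda>e. e + i * D) (es i)) [0..<n]))"
  using assms
proof (induction n)
  case (Suc n)
  hence IH: "ascending_below (n * D) (concat (map (\<lambda>i. map (\<lambda>e. e + i * D) (es i)) [0..<n]))"
    and last: "ascending_below D (es n)" by simp_all
  show ?case using IH last
    by (fastforce simp: ascending_below_def sorted_wrt_append sorted_wrt_map)
qed (simp add: ascending_below_def)

lemma concat_map_product:
  "concat (map h (List.product xs ys)) = concat (map (\<lambda>x. concat (map (\<lambda>y. h (x, y)) ys)) xs)"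
  by (induction xs) (simp_all add: comp_def)

lemma map_snd_shift_monomials: "map snd (shift_monomials d ms) = map (\<lambda>e. e + d) (map snd ms)"
  by (induction ms) (auto simp: shift_monomials_def)

lemma map_snd_negate_monomials: "map snd (negate_monomials ms) = map snd ms"
  by (induction ms) (auto simp: negate_monomials_def)

text \<open>Shifting index by index, instead of by \<open>idx_dot_rho\<close> at once, gives the
  nesting that \<open>ascending_below_concat\<close> needs.\<close>

lemma map_snd_full_expansion:
  "map snd (full_expansion p1 p2 p3) =
    concat (map (\<lambda>i1. map (\<lambda>e. e + i1 * ((p2 - 1) * (p3 - 1)))
     (concat (map (\<lambda>i2. map (\<lambda>e. e + i2 * (p1 * (p3 - 1)))
      (concat (map (\<lambda>i3. map (\<lambda>e. e + i3 * (p3 - 1))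
       (concat (map (\<lambda>i4. map (\<lambda>e. e + i4 * (p1 * p2)) (map snd (f_monomials p1 p2 (i1, i2, i3, i4))))
         [0..<p3 div (p1 * p2)])))
        [0..<p1])))
       [0..<p2 div p1])))
      [0..<p1 - 1])
    @ [totient (p1 * p2 * p3)]"
  by (simp add: full_expansion_def idx_list_def concat_map_product map_concat comp_def
      map_snd_shift_monomials[unfolded map_map comp_def] add.commute add.left_commute)

text \<open>The exponents of \<open>g_monomials\<close> lie strictly between \<open>i1 * p2\<close>
  and \<open>(i1 + 1) * p2\<close>, so the four pieces follow one another, and
  \<open>i1 + 2 <= p1\<close> keeps the last below \<open>p1 * p2\<close>.\<close>

lemma ascending_below_f_monomials:
  assumes q: "p2 = p1 * b + 1" and i: "i1 < p1 - 1" "i2 < b"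
  shows "ascending_below (p1 * p2) (map snd (f_monomials p1 p2 (i1, i2, i3, i4)))"
proof -
  let ?g = "map snd (g_monomials p1 p2 (i1, i2, i3, i4))"
  have i2: "i2 * p1 + p1 \<le> p1 * b"
  proof -
    have "Suc i2 * p1 \<le> b * p1" using i(2) by (intro mult_le_mono1) simp
    thus ?thesis by (simp add: algebra_simps)
  qed
  have i1: "i1 * p2 + p2 + p2 \<le> p1 * p2"
  proof -
    have "(i1 + 2) * p2 \<le> p1 * p2" using i(1) by (intro mult_le_mono1) simp
    thus ?thesis by (simp add: algebra_simps)
  qed
  have e: "i1 * (p2 - 1) + i1 = i1 * p2" using q by (simp add: algebra_simps)
  have sorted: "sorted_wrt (<) ?g"
    by (simp add: sorted_wrt_map comp_def sorted_wrt_upt del: upt_Suc)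
  have upper: "e < i1 * p2 + p2" if "e \<in> set ?g" for e
    using that i i2 e q by (auto split: if_splits)
  have lower: "i1 * p2 < e" if "e \<in> set ?g" for e
    using that i i2 e q by (auto split: if_splits)
  have snd: "map snd (f_monomials p1 p2 (i1, i2, i3, i4)) =
      [0] @ ?g @ [i1 * p2 + p2] @ map (\<lambda>e. e + p2) ?g"
    by (simp add: f_monomials_def map_snd_negate_monomials map_snd_shift_monomials del: g_monomials.simps)
  show ?thesis
    unfolding snd ascending_below_def
    using sorted upper lower i1 q
    by (fastforce simp: sorted_wrt_append sorted_wrt_map simp del: g_monomials.simps map_map)
qed

lemma mult_add_1_div: "D > 1 \<Longrightarrow> (D * n + 1) div D = (n :: nat)"
  using div_mult_self2[of D 1 n] by (simp add: add.commute)

lemma full_expansion_ascending: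
  assumes p2: "p2 = p1 * b + 1" and p3: "p3 = p1 * p2 * c + 1" and p1: "p1 > 1"
    and tot: "totient (p1 * p2 * p3) = (p1 - 1) * ((p2 - 1) * (p3 - 1))"
  shows "sorted_wrt (<) (map snd (full_expansion p1 p2 p3))"
proof -
  have div: "p2 div p1 = b" "p3 div (p1 * p2) = c"
    using mult_add_1_div[of p1 b] mult_add_1_div[of "p1 * p2" c] p1 p2 p3
    by (cases "p2 = 0"; simp)+
  have D: "p3 - 1 = c * (p1 * p2)" "(p2 - 1) * (p3 - 1) = b * (p1 * (p3 - 1))"
    using p2 p3 by simp_all
  let ?es = "\<lambda>i1 i2 i3. concat (map (\<lambda>i4. map (\<lambda>e. e + i4 * (p1 * p2))
    (map snd (f_monomials p1 p2 (i1, i2, i3, i4)))) [0..<c])"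
  have "ascending_below (p3 - 1) (?es i1 i2 i3)" if "i1 < p1 - 1" "i2 < b" for i1 i2 i3
    unfolding D(1) by (intro ascending_below_concat ascending_below_f_monomials[OF p2] that)
  hence "ascending_below ((p1 - 1) * ((p2 - 1) * (p3 - 1)))
     (concat (map (\<lambda>i1. map (\<lambda>e. e + i1 * ((p2 - 1) * (p3 - 1)))
       (concat (map (\<lambda>i2. map (\<lambda>e. e + i2 * (p1 * (p3 - 1)))
         (concat (map (\<lambda>i3. map (\<lambda>e. e + i3 * (p3 - 1)) (?es i1 i2 i3)) [0..<p1])))
         [0..<b])))
       [0..<p1 - 1]))"
    unfolding D(2) by (intro ascending_below_concat)
  \<comment> \<open>The bound on the nested blocks equals the totient, so the final exponent exceeds
    all others.\<close>
  thus ?thesis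
    unfolding map_snd_full_expansion div tot sorted_wrt_append ascending_below_def by simp
qed


section \<open>The expansion for three primes\<close>

lemma f_poly_conv_f_val:
  assumes "i1 < p1 - 1"
  shows "f_poly p1 p2 (i1, i2, i3, i4) = f_val p1 p2 (monom 1 1) i1 i2 i3"
proof -
  have m: "monom 1 n = monom 1 1 ^ n" for n :: nat
    by (simp add: monom_power)
  \<comment> \<open>The bound on \<open>i1\<close> keeps \<open>p1 - 2 - i1\<close> from being cut
    off at 0, so this range has exactly \<open>p1 - 1 - i1\<close> elements.\<close>
  have "{0..p1 - 2 - i1} = {..<p1 - 1 - i1}" "{0..i1} = {..<i1 + 1}"
    using assms by auto
  thus ?thesis
    unfolding f_poly_def f_val_def g_poly.simps geo_def m[of "_ + _"] m[of "_ * _"] m[of p2]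
    by (auto simp: monom_power algebra_simps)
qed

lemma sum_f_poly_mult:
  assumes p2: "p2 = p1 * b + 1" and p3: "p3 = p1 * p2 * c + 1" and p1: "p1 > 1"
  defines "x \<equiv> monom 1 1 :: int poly"
  shows "((\<Sum>i\<in>idx_set p1 p2 p3. f_poly p1 p2 i * monom 1 (idx_dot_rho p1 p2 p3 i))
        + monom 1 ((p1 - 1) * (p2 - 1) * (p3 - 1))) * (x ^ (p1 * p2) - 1) =
     (x ^ p2 - 1) * geo x p1 * cyclo2 p1 b (x ^ p3)"
proof -
  have m: "monom 1 n = x ^ n" for n
    by (simp add: x_def monom_power)
  have div: "p2 div p1 = b" "p3 div (p1 * p2) = c"
    using mult_add_1_div[of p1 b] mult_add_1_div[of "p1 * p2" c] p1 p2 p3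
    by (cases "p2 = 0"; simp)+
  let ?y = "x ^ (p3 - 1)"
  let ?S = "\<Sum>i<p1-1. \<Sum>j<b. \<Sum>k<p1. f_val p1 p2 x i j k * ?y ^ (i * (p2 - 1) + j * p1 + k)"
  have "(\<Sum>i\<in>idx_set p1 p2 p3. f_poly p1 p2 i * monom 1 (idx_dot_rho p1 p2 p3 i)) =
      (\<Sum>i<p1-1. \<Sum>j<b. \<Sum>k<p1. \<Sum>l<c.
        f_poly p1 p2 (i, j, k, l) * monom 1 (idx_dot_rho p1 p2 p3 (i, j, k, l)))"
    unfolding idx_set_def div atLeast0LessThan
    by (simp only: sum.cartesian_product')
  \<comment> \<open>The last index enters only through \<open>x ^ (l * (p1 * p2))\<close>; the rest
    of the exponent is \<open>p3 - 1\<close> times the position of \<open>(i, j, k)\<close>.\<close>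
  also have "\<dots> = (\<Sum>i<p1-1. \<Sum>j<b. \<Sum>k<p1. \<Sum>l<c.
        (f_val p1 p2 x i j k * ?y ^ (i * (p2 - 1) + j * p1 + k)) * x ^ (l * (p1 * p2)))"
    by (intro sum.cong refl)
      (simp add: f_poly_conv_f_val m x_def[symmetric] power_mult[symmetric] power_add[symmetric]
        distrib_left distrib_right ac_simps del: One_nat_def)
  also have "\<dots> = ?S * (\<Sum>l<c. x ^ (l * (p1 * p2)))"
    by (simp only: sum_distrib_right[symmetric] sum_distrib_left[symmetric])
  finally have "((\<Sum>i\<in>idx_set p1 p2 p3. f_poly p1 p2 i * monom 1 (idx_dot_rho p1 p2 p3 i))
        + monom 1 ((p1 - 1) * (p2 - 1) * (p3 - 1))) * (x ^ (p1 * p2) - 1) =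
      ?S * ((\<Sum>l<c. x ^ (l * (p1 * p2))) * (x ^ (p1 * p2) - 1)) +
      ?y ^ ((p1 - 1) * (p2 - 1)) * (x ^ (p1 * p2) - 1)"
    by (simp add: m power_mult[symmetric] mult.commute mult.left_commute distrib_right distrib_left)
  also have "(\<Sum>l<c. x ^ (l * (p1 * p2))) * (x ^ (p1 * p2) - 1) = ?y - 1"
    unfolding geo_power_mult by (simp add: p3 mult.commute)
  also have "?S * (?y - 1) + ?y ^ ((p1 - 1) * (p2 - 1)) * (x ^ (p1 * p2) - 1) =
      (x ^ p2 - 1) * geo x p1 * cyclo2 p1 b (x * ?y)"
    by (rule sum_f_val) (use p1 p2 in simp_all)
  also have "x * ?y = x ^ p3" by (simp add: p3)
  finally show ?thesis .
qed

theorem theorem1: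
  fixes p1 p2 p3 :: nat
  assumes "prime p1" "prime p2" "prime p3"
    and "odd p1" "odd p2" "odd p3"
    and "p1 < p2" "p2 < p3"
    and "[p2 = 1] (mod p1)"
    and "[p3 = 1] (mod (p1 * p2))"
  shows "(cyclotomic_poly (p1 * p2 * p3) =
      (\<Sum>i\<in>idx_set p1 p2 p3. f_poly p1 p2 i * monom 1 (idx_dot_rho p1 p2 p3 i))
        + monom 1 (totient (p1 * p2 * p3)))
    \<and> (distinct (map snd (full_expansion p1 p2 p3)) \<and>
         sorted_wrt (<) (map snd (full_expansion p1 p2 p3)))"
proof -
  have gt1: "p1 > 1" "p2 > 1" "p3 > 1"
    using assms prime_gt_1_nat by blast+
  obtain b where p2: "p2 = p1 * b + 1"
    using cong_to_1_nat[OF assms(9)] gt1 by (metis dvdE le_add_diff_inverse2 less_imp_le)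
  obtain c where p3: "p3 = p1 * p2 * c + 1"
    using cong_to_1_nat[OF assms(10)] gt1 by (metis dvdE le_add_diff_inverse2 less_imp_le)
  have tot: "totient (p1 * p2 * p3) = (p1 - 1) * (p2 - 1) * (p3 - 1)"
  proof -
    have "coprime p1 p2" "coprime (p1 * p2) p3"
      using assms by (auto simp: primes_coprime)
    thus ?thesis using assms by (simp add: totient_mult_coprime totient_prime)
  qed
  define x :: "int poly" where "x = monom 1 1"
  have m: "monom 1 n = x ^ n" for n
    by (simp add: x_def monom_power)
  have nz: "x ^ n - 1 \<noteq> 0" if "n > 0" for n
  proof
    assume "x ^ n - 1 = 0"
    hence "coeff (monom 1 n :: int poly) n = coeff 1 n" by (simp add: m)
    thus False using that by (simp add: coeff_1)
  qed
  define R where "R = (\<Sum>i\<in>idx_set p1 p2 p3. f_poly p1 p2 i * monom 1 (idx_dot_rho p1 p2 p3 i))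
        + monom 1 (totient (p1 * p2 * p3))"
  \<comment> \<open>The denominator in the formula for three primes. \<open>R\<close> and the
    cyclotomic polynomial are shown to agree after multiplication by it, and \<open>nz\<close>
    allows cancelling it.\<close>
  let ?D = "(x ^ (p1 * p2) - 1) * (x ^ (p1 * p3) - 1) * (x ^ (p2 * p3) - 1) * (x - 1)"
  have cyc: "cyclo2 p1 b (x ^ p3) * ((x ^ (p1 * p3) - 1) * (x ^ (p2 * p3) - 1)) =
      (x ^ (p1 * p2 * p3) - 1) * (x ^ p3 - 1)"
    using cyclo2_mult[OF _ p2, of "x ^ p3"] gt1
    by (simp add: power_mult[symmetric] mult.commute mult.left_commute)
  have "R * ?D = (R * (x ^ (p1 * p2) - 1)) * ((x ^ (p1 * p3) - 1) * (x ^ (p2 * p3) - 1) * (x - 1))"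
    by (simp only: mult.assoc)
  also have "R * (x ^ (p1 * p2) - 1) = (x ^ p2 - 1) * geo x p1 * cyclo2 p1 b (x ^ p3)"
    unfolding R_def tot x_def by (rule sum_f_poly_mult[OF p2 p3 gt1(1)])
  also have "\<dots> * ((x ^ (p1 * p3) - 1) * (x ^ (p2 * p3) - 1) * (x - 1)) =
      (x ^ p2 - 1) * (geo x p1 * (x - 1)) *
      (cyclo2 p1 b (x ^ p3) * ((x ^ (p1 * p3) - 1) * (x ^ (p2 * p3) - 1)))"
    by (simp only: mult.assoc mult.commute mult.left_commute)
  also have "\<dots> = (x ^ p2 - 1) * (x ^ p1 - 1) * ((x ^ (p1 * p2 * p3) - 1) * (x ^ p3 - 1))"
    by (simp only: geo_mult cyc)
  also have "\<dots> = cyclotomic_poly (p1 * p2 * p3) * ?D"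
    using cyclotomic_poly_three_primes[of p1 p2 p3] assms
    by (simp add: m mult.commute mult.left_commute)
  finally have "R = cyclotomic_poly (p1 * p2 * p3)"
    using nz[of "p1 * p2"] nz[of "p1 * p3"] nz[of "p2 * p3"] nz[of 1] gt1 by simp
  moreover have "sorted_wrt (<) (map snd (full_expansion p1 p2 p3))"
    by (rule full_expansion_ascending[OF p2 p3 gt1(1)]) (unfold tot, rule mult.assoc)
  ultimately show ?thesis by (simp add: R_def strict_sorted_iff)
qed

end
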